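(* Let $G$ be a group with monoid presentation $\mathrm{mon}\langle X_G, R_G\rangle$, $\theta : X_G^* \to G$ the natural monoid homomorphism, and $X_H, X_K \subseteq X_G^*$ such that $\theta(X_H)$ generates a subgroup $H$ and $\theta(X_K)$ generates a subgroup $K$ of $G$. With new symbols $H,K$, let $T_+ = (\{H,K\}\cup X_G)^*$, $T=\{HwK : w\in X_G^*\}$, and $R = R_G \cup \{(Hh, H) : h \in X_H\} \cup \{(kK, K) : k \in X_K\}$. Suppose the Knuth–Bendix completion algorithm (described in the context), applied to $R$ with a compatible well-ordering on $T_+$, terminates with output $R^C$. Then the restriction of $\to_{R^C}$ to $T$ is a complete rewriting system which is equivalent to the restriction of $\to_R$ to $T$ (i.e. the restrictions to $T$ of $\stackrel{*}{\leftrightarrow}_{R^C}$ and $\stackrel{*}{\leftrightarrow}_R$ coincide).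
   Context: For a rewriting system $R$ on $T_+$, $\to_R$ is the relation $ulv\to urv$ for $(l,r)\in R$, and $\stackrel{*}{\leftrightarrow}_R$ its reflexive symmetric transitive closure. Complete means terminating and confluent. The completion algorithm: (K1) start with $R$ and a well-ordering on $T_+$ compatible with multiplication; (K2) find all overlaps of pairs of rules $(l_1,r_1),(l_2,r_2)$, i.e. $ul_1v=l_2$ or $ul_1=l_2v$, and record the critical pairs $(ur_1v,r_2)$, resp. $(ur_1,r_2v)$; (K3) reduce both terms of each critical pair with respect to $R$; if the reduced terms differ, orient the pair by the well-ordering and add it as a new rule to $R$; (K4) if new rules were added, repeat (K2)–(K3) for pairs involving new rules; otherwise (K5) output the resulting system $R^C$, which is complete on $T_+$ with respect to the ordering.
   Formalization: In step (K1) the rules of R are first oriented by the well-ordering and trivial rules dropped (no change if R is already decreasing); without this the claim can fail, e.g. R_G={(a,aa),(a,1)} with X_H, X_K empty, where R^C=R does not terminate on T. Overlaps are genuine. *)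

theory Defs
  imports "HOL-Algebra.Generated_Groups" "HOL-Library.Confluence"
begin

text \<open>Words over an alphabet \<open>A\<close> are the elements of \<^term>\<open>lists A\<close>.\<close>

type_synonym 'x rules = "('x list \<times> 'x list) set"

definition rewrite :: "'x set \<Rightarrow> 'x rules \<Rightarrow> 'x list \<Rightarrow> 'x list \<Rightarrow> bool" where
  "rewrite A R x y \<longleftrightarrow>
     (\<exists>u l r v. u \<in> lists A \<and> v \<in> lists A \<and> (l, r) \<in> R \<and> x = u @ l @ v \<and> y = u @ r @ v)"

definition terminating :: "('a \<Rightarrow> 'a \<Rightarrow> bool) \<Rightarrow> bool" where
  "terminating rel \<longleftrightarrow> \<not> (\<exists>f :: nat \<Rightarrow> 'a. \<forall>i. rel (f i) (f (Suc i)))"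

definition complete_rel :: "('a \<Rightarrow> 'a \<Rightarrow> bool) \<Rightarrow> bool" where
  "complete_rel rel \<longleftrightarrow> terminating rel \<and> confluentp rel"

definition restrict_to :: "'a set \<Rightarrow> ('a \<Rightarrow> 'a \<Rightarrow> bool) \<Rightarrow> 'a \<Rightarrow> 'a \<Rightarrow> bool" where
  "restrict_to T rel x y \<longleftrightarrow> x \<in> T \<and> y \<in> T \<and> rel x y"

definition free_monoid :: "'x set \<Rightarrow> 'x list monoid" where
  "free_monoid X = \<lparr>carrier = lists X, mult = (@), one = []\<rparr>"

text \<open>\<open>G\<close> is presented by \<open>X\<close> and \<open>R\<close>, i.e. \<open>G\<close> is the quotient of the free monoid on \<open>X\<close> by
  the congruence generated by \<open>R\<close>, and \<open>\<theta>\<close> is the quotient map.\<close>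

definition monoid_presentation ::
    "('g, 'm) monoid_scheme \<Rightarrow> 'x set \<Rightarrow> 'x rules \<Rightarrow> ('x list \<Rightarrow> 'g) \<Rightarrow> bool" where
  "monoid_presentation G X R \<theta> \<longleftrightarrow>
     R \<subseteq> lists X \<times> lists X \<and>
     \<theta> \<in> hom (free_monoid X) G \<and> \<theta> [] = \<one>\<^bsub>G\<^esub> \<and> \<theta> ` lists X = carrier G \<and>
     (\<forall>u \<in> lists X. \<forall>v \<in> lists X. \<theta> u = \<theta> v \<longleftrightarrow> equivclp (rewrite X R) u v)"

text \<open>As usual in HOL, \<open>leq\<close> is the reflexive version of the well-ordering.\<close>

definition compatible_well_order :: "'x set \<Rightarrow> 'x list rel \<Rightarrow> bool" where
  "compatible_well_order A leq \<longleftrightarrow>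
     well_order_on (lists A) leq \<and>
     (\<forall>x y. \<forall>u \<in> lists A. \<forall>v \<in> lists A. (x, y) \<in> leq \<longrightarrow> (u @ x @ v, u @ y @ v) \<in> leq)"


subsection \<open>Knuth-Bendix completion\<close>

text \<open>Drop the trivial pairs and direct the others from the larger word to the smaller one.\<close>

definition orient_rules :: "'x list rel \<Rightarrow> 'x rules \<Rightarrow> 'x rules" where
  "orient_rules leq S =
     {(if (q, p) \<in> leq then (p, q) else (q, p)) | p q. (p, q) \<in> S \<and> p \<noteq> q}"

lemma orient_rules_id:
  assumes "\<And>l r. (l, r) \<in> R \<Longrightarrow> (r, l) \<in> leq \<and> l \<noteq> r"
  shows "orient_rules leq R = R"
  using assms unfolding orient_rules_def by force

text \<open>\<open>critical_pairs R N\<close>: the critical pairs of two rules of \<open>R\<close> at least one of which is in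
  \<open>N\<close>. In \<open>u l\<^sub>1 = l\<^sub>2 v\<close> the condition on the length of \<open>u\<close> says that the occurrences of
  \<open>l\<^sub>1\<close> and \<open>l\<^sub>2\<close> really overlap; equivalently \<open>v\<close> is shorter than \<open>l\<^sub>1\<close>.\<close>

definition critical_pairs :: "'x rules \<Rightarrow> 'x rules \<Rightarrow> ('x list \<times> 'x list) set" where
  "critical_pairs R N =
     {(u @ r1 @ v, r2) | u v l1 r1 l2 r2.
        (l1, r1) \<in> R \<and> (l2, r2) \<in> R \<and> ((l1, r1) \<in> N \<or> (l2, r2) \<in> N) \<and>
        u @ l1 @ v = l2} \<union>
     {(u @ r1, r2 @ v) | u v l1 r1 l2 r2.
        (l1, r1) \<in> R \<and> (l2, r2) \<in> R \<and> ((l1, r1) \<in> N \<or> (l2, r2) \<in> N) \<and>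
        u @ l1 = l2 @ v \<and> length u < length l2}"

definition reduces_to :: "'x set \<Rightarrow> 'x rules \<Rightarrow> 'x list \<Rightarrow> 'x list \<Rightarrow> bool" where
  "reduces_to A R x y \<longleftrightarrow> (rewrite A R)\<^sup>*\<^sup>* x y \<and> \<not> (\<exists>z. rewrite A R y z)"

text \<open>The states of the completion procedure are triples of the current rules \<open>R\<close>, the
  rules \<open>N\<close> added since critical pairs were last computed, and the pending critical pairs
  \<open>P\<close>. In step \<open>K3\<close> any set \<open>Q\<close> of pending pairs is reduced simultaneously, \<open>g\<close> selecting
  the reduced terms. Singleton sets \<open>Q\<close> give the sequential procedure, which adds each new
  rule before it treats the next pair, and \<open>Q = P\<close> gives the procedure which treats
  all pairs with the same rules.

  In \<open>K1\<close> the input is oriented like the new rules in \<open>K3\<close>. By \<open>orient_rules_id\<close>, the procedure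
  starts with \<open>R0\<close> itself if all rules of \<open>R0\<close> are decreasing.\<close>

inductive kb_state ::
    "'x set \<Rightarrow> 'x list rel \<Rightarrow> 'x rules \<Rightarrow> 'x rules \<Rightarrow> 'x rules \<Rightarrow> ('x list \<times> 'x list) set \<Rightarrow> bool"
  for A :: "'x set" and leq :: "'x list rel" and R0 :: "'x rules"
where
  K1_K2: "R = orient_rules leq R0 \<Longrightarrow> kb_state A leq R0 R {} (critical_pairs R R)"
| K3: "\<lbrakk> kb_state A leq R0 R N P; Q \<subseteq> P;
         \<And>p q. (p, q) \<in> Q \<Longrightarrow>
            reduces_to A R p (fst (g (p, q))) \<and> reduces_to A R q (snd (g (p, q)));
         S = orient_rules leq (g ` Q) \<rbrakk>
       \<Longrightarrow> kb_state A leq R0 (R \<union> S) (N \<union> S) (P - Q)"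
| K4: "\<lbrakk> kb_state A leq R0 R N {}; N \<noteq> {} \<rbrakk> \<Longrightarrow> kb_state A leq R0 R {} (critical_pairs R N)"

text \<open>The procedure terminates with output \<open>RC\<close>: no pairs are pending and no rules are new.\<close>

definition kb_output :: "'x set \<Rightarrow> 'x list rel \<Rightarrow> 'x rules \<Rightarrow> 'x rules \<Rightarrow> bool" where
  "kb_output A leq R0 RC \<longleftrightarrow> kb_state A leq R0 RC {} {}"


subsection \<open>Double coset rewriting systems\<close>

definition dc_rules ::
    "'x \<Rightarrow> 'x \<Rightarrow> 'x rules \<Rightarrow> 'x list set \<Rightarrow> 'x list set \<Rightarrow> 'x rules" where
  "dc_rules sH sK RG XH XK =
     RG \<union> {([sH] @ h, [sH]) | h. h \<in> XH} \<union> {(k @ [sK], [sK]) | k. k \<in> XK}"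

definition dc_words :: "'x \<Rightarrow> 'x \<Rightarrow> 'x set \<Rightarrow> 'x list set" where
  "dc_words sH sK X = {[sH] @ w @ [sK] | w. w \<in> lists X}"

end

theory Submission
  imports Defs
begin

text \<open>Every word in a rule or a critical pair that arises during the completion contains \<open>H\<close> at
  most at its first and \<open>K\<close> at most at its last position, and the two words of a pair contain the
  same markers. The left-hand sides are nonempty, because the empty word is the least word.
  Hence \<open>T\<close> is closed under the final rewrite relation, and completeness on \<open>T\<close> is inherited from
  completeness on all words, which is the correctness of the completion procedure
  (critical pair lemma and Newman's lemma).\<close>

section \<open>Abstract rewriting\<close>

text \<open>Newman's lemma, by well-founded induction on the peak \<open>x\<close>:
  \<open>local\<close> joins the two first steps at \<open>w\<close>, then the induction hypothesis
  at \<open>y1\<close> and at \<open>z1\<close> closes the two remaining diamonds.\<close>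

lemma newman:
  assumes "terminating rel"
    and local: "\<And>x y z. rel x y \<Longrightarrow> rel x z \<Longrightarrow> \<exists>w. rel\<^sup>*\<^sup>* y w \<and> rel\<^sup>*\<^sup>* z w"
  shows "confluentp rel"
proof (rule confluentpI)
  have "wf {(y, x). rel x y}"
    using assms(1) unfolding terminating_def wf_iff_no_infinite_down_chain by simp
  then show "\<exists>w. rel\<^sup>*\<^sup>* y w \<and> rel\<^sup>*\<^sup>* z w" if "rel\<^sup>*\<^sup>* x y" "rel\<^sup>*\<^sup>* x z" for x y z
    using that
  proof (induction x arbitrary: y z rule: wf_induct_rule)
    case (less x)
    show ?case
    proof (cases "x = y \<or> x = z")
      case True
      then show ?thesis using less.prems by blast
    next
      case False
      obtain y1 z1 where y1: "rel x y1" "rel\<^sup>*\<^sup>* y1 y" and z1: "rel x z1" "rel\<^sup>*\<^sup>* z1 z"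
        using False less.prems by (metis converse_rtranclpE)
      obtain w where w: "rel\<^sup>*\<^sup>* y1 w" "rel\<^sup>*\<^sup>* z1 w" using local y1(1) z1(1) by blast
      obtain a where a: "rel\<^sup>*\<^sup>* y a" "rel\<^sup>*\<^sup>* w a" using less.IH[of y1 y w] y1 w by auto
      have "rel\<^sup>*\<^sup>* z1 a" using w a by (meson rtranclp_trans)
      then obtain b where "rel\<^sup>*\<^sup>* a b" "rel\<^sup>*\<^sup>* z b" using less.IH[of z1 a z] z1 by auto
      then show ?thesis using a by (meson rtranclp_trans)
    qed
  qed
qed

lemma equivclp_least:
  assumes "\<And>x y. r x y \<Longrightarrow> equivclp s x y"
  shows "equivclp r x y \<Longrightarrow> equivclp s x y"
proof (induction rule: equivclp_induct)
  case (step y z)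
  then show ?case by (meson assms equivclp_sym equivclp_trans)
qed simp

lemma equivclp_eqI:
  assumes "\<And>x y. r x y \<Longrightarrow> equivclp s x y" "\<And>x y. s x y \<Longrightarrow> equivclp r x y"
  shows "equivclp r = equivclp s"
  using equivclp_least[of r s] equivclp_least[of s r] assms by blast

text \<open>A reduction that starts in \<open>T\<close> never leaves it, so a common reduct found
  for \<open>rel\<close> is also one for the restriction.\<close>

lemma complete_rel_restrict_to:
  assumes "complete_rel rel" and closed: "\<And>x y. x \<in> T \<Longrightarrow> rel x y \<Longrightarrow> y \<in> T"
  shows "complete_rel (restrict_to T rel)"
proof -
  have "terminating (restrict_to T rel)"
    using assms(1) unfolding complete_rel_def terminating_def restrict_to_def by blast
  moreover have "confluentp (restrict_to T rel)"
  proof (rule confluentpI)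
    fix x y z
    assume xy: "(restrict_to T rel)\<^sup>*\<^sup>* x y" and xz: "(restrict_to T rel)\<^sup>*\<^sup>* x z"
    have into: "rel\<^sup>*\<^sup>* a b" if "(restrict_to T rel)\<^sup>*\<^sup>* a b" for a b
      using that by (rule rtranclp_mono[THEN predicate2D, rotated]) (auto simp: restrict_to_def)
    have lift: "(restrict_to T rel)\<^sup>*\<^sup>* a b \<and> b \<in> T" if "rel\<^sup>*\<^sup>* a b" "a \<in> T" for a b
      using that
      by (induction rule: rtranclp_induct)
        (auto simp: restrict_to_def closed intro: rtranclp.rtrancl_into_rtrancl)
    show "\<exists>w. (restrict_to T rel)\<^sup>*\<^sup>* y w \<and> (restrict_to T rel)\<^sup>*\<^sup>* z w"
    proof (cases "x \<in> T")
      case True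
      obtain w where w: "rel\<^sup>*\<^sup>* y w" "rel\<^sup>*\<^sup>* z w"
        using assms(1) into[OF xy] into[OF xz] confluentpD unfolding complete_rel_def by metis
      have "y \<in> T" "z \<in> T" using lift[OF into[OF xy] True] lift[OF into[OF xz] True] by auto
      then show ?thesis using lift w by blast
    next
      case False
      \<comment> \<open>Outside \<open>T\<close> the restriction has no step at all.\<close>
      then have "x = y" "x = z"
        using xy xz by (auto simp: restrict_to_def elim: converse_rtranclpE)
      then show ?thesis by blast
    qed
  qed
  ultimately show ?thesis unfolding complete_rel_def by blast
qed


section \<open>String rewriting\<close>

lemma rewriteI:
  "(l, r) \<in> R \<Longrightarrow> u \<in> lists A \<Longrightarrow> v \<in> lists A \<Longrightarrow> rewrite A R (u @ l @ v) (u @ r @ v)"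
  unfolding rewrite_def by blast

lemma rewrite_rule: "(l, r) \<in> R \<Longrightarrow> rewrite A R l r"
  using rewriteI[of l r R "[]" A "[]"] by simp

lemma rewrite_mono: "R \<subseteq> S \<Longrightarrow> rewrite A R x y \<Longrightarrow> rewrite A S x y"
  unfolding rewrite_def by blast

lemma rewrite_rtranclp_mono: "R \<subseteq> S \<Longrightarrow> (rewrite A R)\<^sup>*\<^sup>* x y \<Longrightarrow> (rewrite A S)\<^sup>*\<^sup>* x y"
  by (rule rtranclp_mono[THEN predicate2D, rotated]) (auto intro: rewrite_mono)

lemma rewrite_in_context:
  assumes "rewrite A R x y" "u \<in> lists A" "v \<in> lists A"
  shows "rewrite A R (u @ x @ v) (u @ y @ v)"
proof -
  obtain u' l r v' where *: "u' \<in> lists A" "v' \<in> lists A" "(l, r) \<in> R"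
    "x = u' @ l @ v'" "y = u' @ r @ v'"
    using assms(1) unfolding rewrite_def by blast
  have "rewrite A R ((u @ u') @ l @ v' @ v) ((u @ u') @ r @ v' @ v)"
    using * assms(2,3) by (intro rewriteI) auto
  then show ?thesis using * by simp
qed

lemma rewrite_rtranclp_in_context:
  assumes "(rewrite A R)\<^sup>*\<^sup>* x y" "u \<in> lists A" "v \<in> lists A"
  shows "(rewrite A R)\<^sup>*\<^sup>* (u @ x @ v) (u @ y @ v)"
  using assms(1)
  by (induction rule: rtranclp_induct)
    (auto intro: rtranclp.rtrancl_into_rtrancl rewrite_in_context[OF _ assms(2,3)])

lemma equivclp_rewrite_in_context:
  assumes "equivclp (rewrite A R) x y" "u \<in> lists A" "v \<in> lists A"
  shows "equivclp (rewrite A R) (u @ x @ v) (u @ y @ v)"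
  using assms(1)
  by (induction rule: equivclp_induct)
    (auto intro: equivclp_into_equivclp rewrite_in_context[OF _ assms(2,3)])

text \<open>The generated equivalence is closed under contexts, hence it suffices to compare the
  rules themselves.\<close>

lemma equivclp_rewrite_eqI:
  assumes "\<And>l r. (l, r) \<in> R \<Longrightarrow> equivclp (rewrite A S) l r"
    and "\<And>l r. (l, r) \<in> S \<Longrightarrow> equivclp (rewrite A R) l r"
  shows "equivclp (rewrite A R) = equivclp (rewrite A S)"
proof -
  \<comment> \<open>\<open>R\<close> and \<open>S\<close> are generalised here so that the fact
    serves both directions.\<close>
  have *: "equivclp (rewrite A S) x y"
    if "rewrite A R x y" "\<And>l r. (l, r) \<in> R \<Longrightarrow> equivclp (rewrite A S) l r" for x y R S
    using that unfolding rewrite_def[of A R] by (auto intro: equivclp_rewrite_in_context)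
  show ?thesis by (rule equivclp_eqI) (use * assms in blast)+
qed

lemma rule_in_lists:
  "(l, r) \<in> R \<Longrightarrow> R \<subseteq> lists A \<times> lists A \<Longrightarrow> l \<in> lists A \<and> r \<in> lists A"
  by blast

lemma rewrite_in_lists:
  "rewrite A R x y \<Longrightarrow> R \<subseteq> lists A \<times> lists A \<Longrightarrow> x \<in> lists A \<and> y \<in> lists A"
  unfolding rewrite_def by (metis append_in_lists_conv rule_in_lists)

lemma rewrite_rtranclp_in_lists:
  "(rewrite A R)\<^sup>*\<^sup>* x y \<Longrightarrow> R \<subseteq> lists A \<times> lists A \<Longrightarrow> x \<in> lists A \<Longrightarrow> y \<in> lists A"
  by (induction rule: rtranclp_induct) (auto dest: rewrite_in_lists)


section \<open>Compatible well-orderings\<close>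

lemma compatible_well_order_total:
  "compatible_well_order A leq \<Longrightarrow> x \<in> lists A \<Longrightarrow> y \<in> lists A \<Longrightarrow> x \<noteq> y \<Longrightarrow>
    (x, y) \<in> leq \<or> (y, x) \<in> leq"
  unfolding compatible_well_order_def well_order_on_def linear_order_on_def total_on_def by blast

lemma compatible_well_order_wf: "compatible_well_order A leq \<Longrightarrow> wf (leq - Id)"
  unfolding compatible_well_order_def well_order_on_def by blast

lemma compatible_well_order_context:
  "compatible_well_order A leq \<Longrightarrow> (x, y) \<in> leq - Id \<Longrightarrow> u \<in> lists A \<Longrightarrow> v \<in> lists A \<Longrightarrow>
    (u @ x @ v, u @ y @ v) \<in> leq - Id"
  unfolding compatible_well_order_def by auto

text \<open>If \<open>r < []\<close>, then \<open>m r < m\<close> for every \<open>m\<close>, so there is no least word.\<close>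

lemma compatible_well_order_not_less_Nil:
  assumes "compatible_well_order A leq" "r \<in> lists A"
  shows "(r, []) \<notin> leq - Id"
proof
  assume r: "(r, []) \<in> leq - Id"
  obtain m where m: "m \<in> lists A" "\<And>y. (y, m) \<in> leq - Id \<Longrightarrow> y \<notin> lists A"
    using wfE_min[OF compatible_well_order_wf[OF assms(1)], of "[]" "lists A"] by auto
  have "(m @ r, m) \<in> leq - Id"
    using compatible_well_order_context[OF assms(1) r m(1), of "[]"] by simp
  moreover have "m @ r \<in> lists A" using m(1) assms(2) by simp
  ultimately show False using m(2) by blast
qed

text \<open>An invariant of the completion. As \<open>leq\<close> is reflexive,
  \<open>leq - Id\<close> is the strict order.\<close>

definition decreasing_rules :: "'x set \<Rightarrow> 'x list rel \<Rightarrow> 'x rules \<Rightarrow> bool" where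
  "decreasing_rules A leq R \<longleftrightarrow>
     (\<forall>(l, r) \<in> R. l \<in> lists A \<and> r \<in> lists A \<and> (r, l) \<in> leq - Id)"

lemma decreasing_rules_in_lists: "decreasing_rules A leq R \<Longrightarrow> R \<subseteq> lists A \<times> lists A"
  unfolding decreasing_rules_def by auto

lemma decreasing_rules_nonempty:
  assumes "compatible_well_order A leq" "decreasing_rules A leq R" "(l, r) \<in> R"
  shows "l \<noteq> []"
  using compatible_well_order_not_less_Nil[OF assms(1)] assms(2,3)
  unfolding decreasing_rules_def by blast

text \<open>Compatibility carries the strict descent from a rule to every step that uses it, and the
  strict order is well-founded.\<close>

lemma terminating_rewrite:
  assumes "compatible_well_order A leq" "decreasing_rules A leq R"
  shows "terminating (rewrite A R)"
proof -
  have "(y, x) \<in> leq - Id" if xy: "rewrite A R x y" for x y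
  proof -
    obtain u l r v where *: "u \<in> lists A" "v \<in> lists A" "(l, r) \<in> R" "x = u @ l @ v" "y = u @ r @ v"
      using xy unfolding rewrite_def by blast
    then have "(r, l) \<in> leq - Id" using assms(2) unfolding decreasing_rules_def by blast
    then show ?thesis unfolding *(4,5) by (rule compatible_well_order_context[OF assms(1) _ *(1,2)])
  qed
  then show ?thesis
    using compatible_well_order_wf[OF assms(1)]
    unfolding terminating_def wf_iff_no_infinite_down_chain by metis
qed

section \<open>Orienting pairs into rules\<close>

lemma orient_rulesE:
  assumes "(l, r) \<in> orient_rules leq S"
  shows "l \<noteq> r" "(l, r) \<in> S \<or> (r, l) \<in> S"
  using assms unfolding orient_rules_def by (auto split: if_splits)

lemma orient_rulesI:
  assumes "(p, q) \<in> S" "p \<noteq> q"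
  shows "(p, q) \<in> orient_rules leq S \<or> (q, p) \<in> orient_rules leq S"
  using assms unfolding orient_rules_def by auto

lemma decreasing_orient_rules:
  assumes "compatible_well_order A leq" "S \<subseteq> lists A \<times> lists A"
  shows "decreasing_rules A leq (orient_rules leq S)"
proof -
  have "l \<in> lists A \<and> r \<in> lists A \<and> (r, l) \<in> leq - Id" if "(l, r) \<in> orient_rules leq S" for l r
  proof -
    have "l \<in> lists A" "r \<in> lists A" "l \<noteq> r"
      using orient_rulesE[OF that] assms(2) by blast+
    \<comment> \<open>The first alternative comes from a pair kept as it stands, the second from a
      swapped one; totality turns the second into the first.\<close>
    moreover have "(r, l) \<in> leq \<or> (l, r) \<notin> leq"
      using that unfolding orient_rules_def by (auto split: if_splits)
    ultimately show ?thesis using compatible_well_order_total[OF assms(1)] by blast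
  qed
  then show ?thesis unfolding decreasing_rules_def by auto
qed

text \<open>An equivalence is indifferent to swapped and to trivial pairs, so orienting the input in
  \<open>K1_K2\<close> preserves the generated congruence.\<close>

lemma equivclp_rewrite_orient_rules:
  "equivclp (rewrite A (orient_rules leq S)) = equivclp (rewrite A S)"
proof (rule equivclp_rewrite_eqI)
  show "equivclp (rewrite A S) l r" if "(l, r) \<in> orient_rules leq S" for l r
    using orient_rulesE[OF that] by (auto intro: rewrite_rule)
  show "equivclp (rewrite A (orient_rules leq S)) l r" if "(l, r) \<in> S" for l r
  proof (cases "l = r")
    case False
    then show ?thesis using orient_rulesI[OF that] by (auto intro: rewrite_rule)
  qed simp
qed


section \<open>Critical pairs\<close>

lemma critical_pairs_containedI:
  "(l1, r1) \<in> R \<Longrightarrow> (u @ l1 @ v, r2) \<in> R \<Longrightarrow> (l1, r1) \<in> N \<or> (u @ l1 @ v, r2) \<in> N \<Longrightarrow>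
    (u @ r1 @ v, r2) \<in> critical_pairs R N"
  unfolding critical_pairs_def by blast

lemma critical_pairs_overlapI:
  "(l1, r1) \<in> R \<Longrightarrow> (l2, r2) \<in> R \<Longrightarrow> (l1, r1) \<in> N \<or> (l2, r2) \<in> N \<Longrightarrow>
    u @ l1 = l2 @ v \<Longrightarrow> length u < length l2 \<Longrightarrow> (u @ r1, r2 @ v) \<in> critical_pairs R N"
  unfolding critical_pairs_def by blast

text \<open>Makes the common part \<open>m\<close> of a proper overlap explicit, so that the
  superposed word reads \<open>u @ m @ v\<close>.\<close>

lemma critical_pairsE:
  assumes "(p, q) \<in> critical_pairs R N"
  obtains (contained) u v l1 r1 r2 where "(l1, r1) \<in> R" "(u @ l1 @ v, r2) \<in> R"
      "p = u @ r1 @ v" "q = r2"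
    | (overlap) u m v r1 r2 where "(m @ v, r1) \<in> R" "(u @ m, r2) \<in> R" "m \<noteq> []"
      "p = u @ r1" "q = r2 @ v"
proof -
  consider u v l1 r1 l2 where "(l1, r1) \<in> R" "(l2, q) \<in> R" "u @ l1 @ v = l2" "p = u @ r1 @ v"
    | u v l1 r1 l2 r2 where "(l1, r1) \<in> R" "(l2, r2) \<in> R" "u @ l1 = l2 @ v" "length u < length l2"
      "p = u @ r1" "q = r2 @ v"
    using assms unfolding critical_pairs_def by blast
  then show thesis
  proof cases
    case 1
    then show ?thesis using contained by blast
  next
    case (2 u v l1 r1 l2 r2)
    \<comment> \<open>The length condition excludes that \<open>u\<close> extends beyond
      \<open>l2\<close>, and it makes \<open>m\<close> nonempty.\<close>
    then obtain m where "l2 = u @ m" "l1 = m @ v" by (auto simp: append_eq_append_conv2)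
    then show ?thesis using 2 overlap[of m v r1 u r2] by auto
  qed
qed

lemma critical_pairs_in_lists:
  assumes "R \<subseteq> lists A \<times> lists A"
  shows "critical_pairs R N \<subseteq> lists A \<times> lists A"
proof (rule subrelI)
  fix p q assume "(p, q) \<in> critical_pairs R N"
  then have "p \<in> lists A \<and> q \<in> lists A"
    by (cases rule: critical_pairsE) (use rule_in_lists[OF _ assms] append_in_lists_conv in metis)+
  then show "(p, q) \<in> lists A \<times> lists A" by blast
qed

text \<open>Both words are one-step reducts of the superposed word. The contexts \<open>u\<close>
  and \<open>v\<close> are words over \<open>A\<close> because they are factors of left-hand
  sides.\<close>

lemma critical_pairs_equivclp:
  assumes "R \<subseteq> lists A \<times> lists A" "(p, q) \<in> critical_pairs R N"
  shows "equivclp (rewrite A R) p q"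
  using assms(2)
proof (cases rule: critical_pairsE)
  case (contained u v l1 r1 r2)
  then have "u \<in> lists A" "v \<in> lists A" using rule_in_lists[OF contained(2) assms(1)] by auto
  then have "rewrite A R (u @ l1 @ v) p" using contained rewriteI by metis
  moreover have "rewrite A R (u @ l1 @ v) q"
    using contained by (auto intro: rewrite_rule)
  ultimately show ?thesis by (meson converse_r_into_equivclp equivclp_into_equivclp)
next
  case (overlap u m v r1 r2)
  have "u \<in> lists A" "v \<in> lists A"
    using rule_in_lists[OF overlap(1) assms(1)] rule_in_lists[OF overlap(2) assms(1)] by auto
  then have "rewrite A R (u @ m @ v) p" "rewrite A R (u @ m @ v) q"
    using rewriteI[OF overlap(1), of u A "[]"] rewriteI[OF overlap(2), of "[]" A v] overlap
    by simp_all
  then show ?thesis by (meson converse_r_into_equivclp equivclp_into_equivclp)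
qed

definition joinable :: "'x set \<Rightarrow> 'x rules \<Rightarrow> 'x list \<Rightarrow> 'x list \<Rightarrow> bool" where
  "joinable A R x y \<longleftrightarrow> (\<exists>w. (rewrite A R)\<^sup>*\<^sup>* x w \<and> (rewrite A R)\<^sup>*\<^sup>* y w)"

lemma joinable_sym: "joinable A R x y \<Longrightarrow> joinable A R y x"
  unfolding joinable_def by blast

lemma joinable_mono: "R \<subseteq> S \<Longrightarrow> joinable A R x y \<Longrightarrow> joinable A S x y"
  unfolding joinable_def by (meson rewrite_rtranclp_mono)

lemma joinable_in_context:
  "joinable A R x y \<Longrightarrow> u \<in> lists A \<Longrightarrow> v \<in> lists A \<Longrightarrow> joinable A R (u @ x @ v) (u @ y @ v)"
  unfolding joinable_def by (meson rewrite_rtranclp_in_context)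

text \<open>The position of the second redex relative to the first decides whether the redexes are
  disjoint, properly overlapping or nested.\<close>

lemma critical_pair_lemma_ordered:
  assumes R: "R \<subseteq> lists A \<times> lists A"
    and cp: "\<And>p q. (p, q) \<in> critical_pairs R R \<Longrightarrow> joinable A R p q"
    and rules: "(l1, r1) \<in> R" "(l2, r2) \<in> R"
    and lists: "u1 \<in> lists A" "v1 \<in> lists A" "u2 \<in> lists A" "v2 \<in> lists A"
    and eq: "u1 @ l1 @ v1 = u2 @ l2 @ v2" and le: "length u1 \<le> length u2"
  shows "joinable A R (u1 @ r1 @ v1) (u2 @ r2 @ v2)"
proof -
  have rules_lists: "r1 \<in> lists A" "r2 \<in> lists A" using rules R by blast+
  \<comment> \<open>\<open>d\<close> is the piece between the starts of the two redexes.\<close>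
  obtain d where d: "u2 = u1 @ d" "l1 @ v1 = d @ l2 @ v2"
    using append_eq_append_conv2[THEN iffD1, OF eq] le by (elim exE disjE) auto
  obtain m where "l1 = d @ m \<and> m @ v1 = l2 @ v2 \<or> d = l1 @ m \<and> v1 = m @ l2 @ v2"
    using append_eq_append_conv2[THEN iffD1, OF d(2)] by metis
  \<comment> \<open>If \<open>m\<close> is empty the redexes merely touch; this counts as disjoint
    with \<open>e = []\<close>.\<close>
  then consider e where "d = l1 @ e" "v1 = e @ l2 @ v2"
    | m where "l1 = d @ m" "m @ v1 = l2 @ v2" "m \<noteq> []"
    by (metis append.right_neutral append_Nil)
  then show ?thesis
  proof cases
    case (1 e)
    \<comment> \<open>Disjoint redexes: contracting the other one in each reduct yields the same
      word.\<close>
    have "rewrite A R (u1 @ r1 @ v1) (u1 @ r1 @ e @ r2 @ v2)"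
      using rewriteI[OF rules(2), of "u1 @ r1 @ e" A v2] 1 d lists rules_lists by simp
    moreover have "rewrite A R (u2 @ r2 @ v2) (u1 @ r1 @ e @ r2 @ v2)"
      using rewriteI[OF rules(1), of u1 A "e @ r2 @ v2"] 1 d lists rules_lists by simp
    ultimately show ?thesis unfolding joinable_def by blast
  next
    case (2 m)
    consider w where "l2 = m @ w" "v1 = w @ v2" | w where "m = l2 @ w" "v2 = w @ v1"
      using append_eq_append_conv2[THEN iffD1, OF 2(2)] by metis
    then show ?thesis
    proof cases
      case (1 w)
      \<comment> \<open>The two rules enter in exchanged order: \<open>d @ l2 = l1 @ w\<close>,
        where \<open>m \<noteq> []\<close> gives \<open>length d < length l1\<close>.\<close>
      have "joinable A R (d @ r2) (r1 @ w)"
        by (rule cp, rule critical_pairs_overlapI[OF rules(2,1)]) (use 1 2 rules in auto)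
      then have "joinable A R (u1 @ (d @ r2) @ v2) (u1 @ (r1 @ w) @ v2)"
        by (rule joinable_in_context) (use lists in auto)
      then show ?thesis using 1 d by (auto intro: joinable_sym)
    next
      case (2 w)
      \<comment> \<open>Here the second redex is nested in the first:
        \<open>l1 = d @ l2 @ w\<close>.\<close>
      have "joinable A R (d @ r2 @ w) r1"
        by (rule cp, rule critical_pairs_containedI[OF rules(2)])
          (use 2 \<open>l1 = d @ m\<close> rules in auto)
      then have "joinable A R (u1 @ (d @ r2 @ w) @ v1) (u1 @ r1 @ v1)"
        by (rule joinable_in_context) (use lists in auto)
      then show ?thesis using 2 d by (auto intro: joinable_sym)
    qed
  qed
qed

text \<open>Exchanging the two steps if necessary, the redex of the first one may be assumed to
  start no later than the other.\<close>

lemma critical_pair_lemma: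
  assumes "R \<subseteq> lists A \<times> lists A"
    and "\<And>p q. (p, q) \<in> critical_pairs R R \<Longrightarrow> joinable A R p q"
    and "rewrite A R x y" "rewrite A R x z"
  shows "joinable A R y z"
proof -
  obtain u1 l1 r1 v1 where 1: "u1 \<in> lists A" "v1 \<in> lists A" "(l1, r1) \<in> R"
    "x = u1 @ l1 @ v1" "y = u1 @ r1 @ v1"
    using assms(3) unfolding rewrite_def by blast
  obtain u2 l2 r2 v2 where 2: "u2 \<in> lists A" "v2 \<in> lists A" "(l2, r2) \<in> R"
    "x = u2 @ l2 @ v2" "z = u2 @ r2 @ v2"
    using assms(4) unfolding rewrite_def by blast
  show ?thesis
  proof (cases "length u1 \<le> length u2")
    case True
    then show ?thesis
      using critical_pair_lemma_ordered[OF assms(1,2) 1(3) 2(3) 1(1,2) 2(1,2)] 1 2 by simp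
  next
    case False
    then show ?thesis
      using critical_pair_lemma_ordered[OF assms(1,2) 2(3) 1(3) 2(1,2) 1(1,2)] 1 2
      by (simp add: joinable_sym)
  qed
qed


section \<open>Correctness of the completion procedure\<close>

text \<open>Words over \<open>A\<close> reduce to words over \<open>A\<close>, so orientation is
  only applied to such pairs, and totality of the order makes the resulting rules
  decreasing.\<close>

lemma kb_state_decreasing:
  assumes "kb_state A leq R0 R N P" "compatible_well_order A leq" "R0 \<subseteq> lists A \<times> lists A"
  shows "decreasing_rules A leq R \<and> P \<subseteq> lists A \<times> lists A"
  using assms(1)
proof (induction rule: kb_state.induct)
  case (K1_K2 R)
  then have "decreasing_rules A leq R" using decreasing_orient_rules assms(2,3) by blast
  then show ?case
    using critical_pairs_in_lists[of R A] decreasing_rules_in_lists[of A leq R] by blast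
next
  case (K3 R N P Q g S)
  have "g ` Q \<subseteq> lists A \<times> lists A"
  proof
    fix x assume "x \<in> g ` Q"
    then obtain p q where pq: "(p, q) \<in> Q" "x = g (p, q)" by auto
    have R: "R \<subseteq> lists A \<times> lists A" using K3.IH decreasing_rules_in_lists by blast
    have "p \<in> lists A" "q \<in> lists A" using K3.IH K3.hyps(2) pq(1) by blast+
    then have "fst x \<in> lists A \<and> snd x \<in> lists A"
      using K3.hyps(3)[OF pq(1)] rewrite_rtranclp_in_lists[OF _ R] pq(2)
      unfolding reduces_to_def by auto
    then show "x \<in> lists A \<times> lists A" by (simp add: mem_Times_iff)
  qed
  then have "decreasing_rules A leq S" using decreasing_orient_rules[OF assms(2)] K3.hyps(4) by simp
  moreover have "decreasing_rules A leq R" "P - Q \<subseteq> lists A \<times> lists A" using K3.IH by auto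
  ultimately show ?case by (simp add: decreasing_rules_def ball_Un)
next
  case (K4 R N)
  then show ?case
    using critical_pairs_in_lists[of R A] decreasing_rules_in_lists[of A leq R] by blast
qed

text \<open>A new rule relates reducts of a pending pair, whose words are already equivalent.
  Pending pairs are compared via \<open>R0\<close>, which stays fixed while \<open>R\<close>
  grows.\<close>

lemma kb_state_equivclp:
  assumes "kb_state A leq R0 R N P" "compatible_well_order A leq" "R0 \<subseteq> lists A \<times> lists A"
  shows "equivclp (rewrite A R) = equivclp (rewrite A R0) \<and>
    (\<forall>(p, q) \<in> P. equivclp (rewrite A R0) p q)"
  using assms(1)
proof (induction rule: kb_state.induct)
  case (K1_K2 R)
  have "R \<subseteq> lists A \<times> lists A"
    using K1_K2 decreasing_orient_rules[OF assms(2,3)] decreasing_rules_in_lists by blast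
  moreover have "equivclp (rewrite A R) = equivclp (rewrite A R0)"
    using K1_K2 equivclp_rewrite_orient_rules by simp
  ultimately show ?case using critical_pairs_equivclp[of R A] by auto
next
  case (K3 R N P Q g S)
  let ?E = "equivclp (rewrite A R)"
  have E: "?E = equivclp (rewrite A R0)" using K3.IH by blast
  \<comment> \<open>The chain is \<open>p'\<close>, \<open>p\<close>, \<open>q\<close>,
    \<open>q'\<close>: reduction, pending pair, reduction.\<close>
  have g: "?E p' q'" if gQ: "(p', q') \<in> g ` Q" for p' q'
  proof -
    obtain p q where pq: "(p, q) \<in> Q" "g (p, q) = (p', q')" using gQ by (metis imageE surj_pair)
    have "?E p q" using K3.IH K3.hyps(2) pq(1) by auto
    moreover have "?E p p'" "?E q q'"
      using K3.hyps(3)[OF pq(1)] pq(2) by (auto simp: reduces_to_def intro: rtranclp_into_equivclp)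
    ultimately show ?thesis by (meson equivclp_sym equivclp_trans)
  qed
  have "equivclp (rewrite A (R \<union> S)) = ?E"
  proof (rule equivclp_rewrite_eqI)
    show "?E l r" if "(l, r) \<in> R \<union> S" for l r
      using that orient_rulesE(2)[of l r leq "g ` Q"] g K3.hyps(4)
      by (auto intro: rewrite_rule equivclp_sym)
    show "equivclp (rewrite A (R \<union> S)) l r" if "(l, r) \<in> R" for l r
      using that by (auto intro: rewrite_rule)
  qed
  then show ?case using E K3.IH by auto
next
  case (K4 R N)
  then have "R \<subseteq> lists A \<times> lists A"
    using kb_state_decreasing[OF _ assms(2,3)] decreasing_rules_in_lists by blast
  then show ?case using K4.IH critical_pairs_equivclp[of R A] by auto
qed

section \<open>Critical pairs of a growing rule set\<close>

lemma critical_pairs_mono: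
  assumes "R \<subseteq> R'" "N \<subseteq> N'"
  shows "critical_pairs R N \<subseteq> critical_pairs R' N'"
proof (rule subrelI)
  fix p q assume "(p, q) \<in> critical_pairs R N"
  then consider u v l1 r1 where "(l1, r1) \<in> R" "(u @ l1 @ v, q) \<in> R"
      "(l1, r1) \<in> N \<or> (u @ l1 @ v, q) \<in> N" "p = u @ r1 @ v"
    | u v l1 r1 l2 r2 where "(l1, r1) \<in> R" "(l2, r2) \<in> R" "(l1, r1) \<in> N \<or> (l2, r2) \<in> N"
      "u @ l1 = l2 @ v" "length u < length l2" "p = u @ r1" "q = r2 @ v"
    unfolding critical_pairs_def by blast
  then show "(p, q) \<in> critical_pairs R' N'"
  proof cases
    case (1 u v l1 r1)
    then show ?thesis using critical_pairs_containedI[of l1 r1 R' u v q N'] assms by blast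
  next
    case (2 u v l1 r1 l2 r2)
    then show ?thesis using critical_pairs_overlapI[of l1 r1 R' l2 r2 N' u v] assms by blast
  qed
qed

text \<open>Two rules of \<open>R \<union> S\<close> either both lie in \<open>R\<close> or one of
  them lies in \<open>S\<close>. This justifies that \<open>K4\<close> only looks at pairs involving
  new rules.\<close>

lemma critical_pairs_Un:
  "critical_pairs (R \<union> S) (R \<union> S) \<subseteq> critical_pairs R R \<union> critical_pairs (R \<union> S) S"
proof (rule subrelI)
  fix p q assume "(p, q) \<in> critical_pairs (R \<union> S) (R \<union> S)"
  then consider u v l1 r1 where "(l1, r1) \<in> R \<union> S" "(u @ l1 @ v, q) \<in> R \<union> S" "p = u @ r1 @ v"
    | u v l1 r1 l2 r2 where "(l1, r1) \<in> R \<union> S" "(l2, r2) \<in> R \<union> S" "u @ l1 = l2 @ v"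
      "length u < length l2" "p = u @ r1" "q = r2 @ v"
    unfolding critical_pairs_def by blast
  then show "(p, q) \<in> critical_pairs R R \<union> critical_pairs (R \<union> S) S"
  proof cases
    case (1 u v l1 r1)
    then show ?thesis
      using critical_pairs_containedI[of l1 r1 R u v q R]
        critical_pairs_containedI[of l1 r1 "R \<union> S" u v q S] by blast
  next
    case (2 u v l1 r1 l2 r2)
    then show ?thesis
      using critical_pairs_overlapI[of l1 r1 R l2 r2 R u v]
        critical_pairs_overlapI[of l1 r1 "R \<union> S" l2 r2 S u v] by blast
  qed
qed

text \<open>The invariant behind confluence: a critical pair not yet joinable is either pending or
  involves a rule of \<open>N\<close>, and then the next \<open>K4\<close> makes it pending.\<close>

lemma kb_state_critical_pairs:
  assumes "kb_state A leq R0 R N P" "(p, q) \<in> critical_pairs R R"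
  shows "(p, q) \<in> P \<or> joinable A R p q \<or> (p, q) \<in> critical_pairs R N"
  using assms
proof (induction arbitrary: p q rule: kb_state.induct)
  case (K3 R N P Q g S)
  \<comment> \<open>The reduced terms are equal or form a rule of \<open>S\<close> in one direction,
    so at most one further step joins them.\<close>
  have reduced: "joinable A (R \<union> S) p q" if "(p, q) \<in> Q"
  proof -
    obtain p' q' where g: "g (p, q) = (p', q')" by fastforce
    have "(rewrite A (R \<union> S))\<^sup>*\<^sup>* p p'" "(rewrite A (R \<union> S))\<^sup>*\<^sup>* q q'"
      using K3.hyps(3)[OF that] g unfolding reduces_to_def
      by (auto intro: rewrite_rtranclp_mono[of R])
    moreover have "p' = q' \<or> (p', q') \<in> S \<or> (q', p') \<in> S"
      using orient_rulesI[of p' q' "g ` Q"] g that K3.hyps(4) by (metis image_eqI)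
    then have "p' = q' \<or> rewrite A (R \<union> S) p' q' \<or> rewrite A (R \<union> S) q' p'"
      by (auto intro: rewrite_rule)
    ultimately show ?thesis
      unfolding joinable_def by (meson rtranclp.rtrancl_into_rtrancl)
  qed
  \<comment> \<open>An old pair keeps its status or has just been reduced; a pair involving
    \<open>S\<close> is covered by the enlarged \<open>N \<union> S\<close>.\<close>
  consider "(p, q) \<in> critical_pairs R R" | "(p, q) \<in> critical_pairs (R \<union> S) S"
    using critical_pairs_Un K3.prems by blast
  then show ?case
  proof cases
    case 1
    then show ?thesis
      using K3.IH[OF 1] reduced joinable_mono[of R "R \<union> S"]
        critical_pairs_mono[of R "R \<union> S" N "N \<union> S"] by blast
  next
    case 2
    then show ?thesis using critical_pairs_mono[of "R \<union> S" "R \<union> S" S "N \<union> S"] by blast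
  qed
\<comment> \<open>In \<open>K1_K2\<close> every critical pair is pending; in \<open>K4\<close>
  nothing was pending before, and the pairs involving \<open>N\<close> become pending.\<close>
qed blast+

theorem kb_output_correct:
  assumes "kb_output A leq R0 RC" "compatible_well_order A leq" "R0 \<subseteq> lists A \<times> lists A"
  shows "complete_rel (rewrite A RC)"
    and "equivclp (rewrite A RC) = equivclp (rewrite A R0)"
proof -
  have state: "kb_state A leq R0 RC {} {}" using assms(1) unfolding kb_output_def .
  have dec: "decreasing_rules A leq RC" using kb_state_decreasing[OF state assms(2,3)] by blast
  \<comment> \<open>Nothing is pending and \<open>critical_pairs RC {}\<close> is empty, so only
    joinability remains.\<close>
  have "joinable A RC p q" if "(p, q) \<in> critical_pairs RC RC" for p q
    using kb_state_critical_pairs[OF state that] unfolding critical_pairs_def by blast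
  then have "joinable A RC y z" if "rewrite A RC x y" "rewrite A RC x z" for x y z
    using critical_pair_lemma[OF decreasing_rules_in_lists[OF dec]] that by blast
  moreover have sn: "terminating (rewrite A RC)" using terminating_rewrite[OF assms(2) dec] .
  ultimately have "confluentp (rewrite A RC)"
    unfolding joinable_def by (intro newman) blast+
  with sn show "complete_rel (rewrite A RC)" unfolding complete_rel_def by blast
  show "equivclp (rewrite A RC) = equivclp (rewrite A R0)"
    using kb_state_equivclp[OF state assms(2,3)] by blast
qed


section \<open>Words with markers at their ends\<close>

text \<open>Words with one marker or none are included, so that all three kinds of rules fall under
  one invariant; the empty word qualifies because \<open>tl []\<close> and \<open>butlast []\<close>
  are empty.\<close>

definition marker_word :: "'x \<Rightarrow> 'x \<Rightarrow> 'x list \<Rightarrow> bool" where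
  "marker_word a b x \<longleftrightarrow> a \<notin> set (tl x) \<and> b \<notin> set (butlast x)"

text \<open>The place of a marker in a marker word is forced, so comparing presence is
  enough.\<close>

definition same_markers :: "'x \<Rightarrow> 'x \<Rightarrow> 'x list \<Rightarrow> 'x list \<Rightarrow> bool" where
  "same_markers a b x y \<longleftrightarrow> marker_word a b x \<and> marker_word a b y \<and>
     (a \<in> set x \<longleftrightarrow> a \<in> set y) \<and> (b \<in> set x \<longleftrightarrow> b \<in> set y)"

lemma same_markers_sym: "same_markers a b x y \<Longrightarrow> same_markers a b y x"
  unfolding same_markers_def by blast

lemma same_markers_trans:
  "same_markers a b x y \<Longrightarrow> same_markers a b y z \<Longrightarrow> same_markers a b x z"
  unfolding same_markers_def by blast

lemma in_set_tlD: "x \<in> set (tl xs) \<Longrightarrow> x \<in> set xs"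
  by (cases xs) auto

lemma set_tl_append: "set (tl (x @ y)) = (if x = [] then set (tl y) else set (tl x) \<union> set y)"
  by (cases x) auto

lemma set_butlast_append:
  "set (butlast (x @ y)) = (if y = [] then set (butlast x) else set x \<union> set (butlast y))"
  by (auto simp: butlast_append)

text \<open>If \<open>l\<close> contains \<open>a\<close> then \<open>u\<close> is empty, and if it
  contains \<open>b\<close> then \<open>v\<close> is empty, so \<open>r\<close> puts the markers
  back at the ends. As \<open>l\<close> is nonempty, \<open>a\<close> is not in \<open>v\<close> and
  \<open>b\<close> is not in \<open>u\<close>; inserting \<open>r\<close> for an empty
  \<open>l\<close> could push such a marker inwards.\<close>

lemma same_markers_replace:
  assumes "same_markers a b l r" "l \<noteq> []" "marker_word a b (u @ l @ v)"
  shows "same_markers a b (u @ l @ v) (u @ r @ v)"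
  using assms unfolding same_markers_def marker_word_def
  by (auto simp: set_tl_append set_butlast_append dest: in_set_tlD in_set_butlastD split: if_splits)

text \<open>If the overlap were empty, a marker could end up in the interior of the word.\<close>

lemma marker_word_overlap:
  assumes "marker_word a b (u @ m)" "marker_word a b (m @ v)" "m \<noteq> []"
  shows "marker_word a b (u @ m @ v)"
  using assms unfolding marker_word_def
  by (auto simp: set_tl_append set_butlast_append dest: in_set_tlD in_set_butlastD split: if_splits)

text \<open>Each word replaces one factor of the superposed word, which is a marker word: it is a
  left-hand side in the contained case, and \<open>marker_word_overlap\<close> applies in the
  other.\<close>

lemma critical_pairs_same_markers:
  assumes "\<And>l r. (l, r) \<in> R \<Longrightarrow> l \<noteq> [] \<and> same_markers a b l r"
    and "(p, q) \<in> critical_pairs R N"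
  shows "same_markers a b p q"
  using assms(2)
proof (cases rule: critical_pairsE)
  case (contained u v l1 r1 r2)
  have "same_markers a b (u @ l1 @ v) q" using assms(1) contained by blast
  moreover have "same_markers a b (u @ l1 @ v) p"
    using same_markers_replace[of a b l1 r1 u v] assms(1) contained calculation
    unfolding same_markers_def by blast
  ultimately show ?thesis by (meson same_markers_sym same_markers_trans)
next
  case (overlap u m v r1 r2)
  have rules: "same_markers a b (m @ v) r1" "same_markers a b (u @ m) r2"
    using assms(1) overlap by blast+
  then have "marker_word a b (u @ m @ v)"
    using marker_word_overlap overlap(3) unfolding same_markers_def by metis
  then have "same_markers a b (u @ m @ v) p" "same_markers a b (u @ m @ v) q"
    using same_markers_replace[OF rules(1), of u "[]"]
      same_markers_replace[OF rules(2), of "[]" v] overlap by auto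
  then show ?thesis by (meson same_markers_sym same_markers_trans)
qed

lemma rewrite_same_markers:
  assumes "\<And>l r. (l, r) \<in> R \<Longrightarrow> l \<noteq> [] \<and> same_markers a b l r"
    and "rewrite A R x y" "marker_word a b x"
  shows "same_markers a b x y"
proof -
  obtain u l r v where *: "(l, r) \<in> R" "x = u @ l @ v" "y = u @ r @ v"
    using assms(2) unfolding rewrite_def by blast
  then show ?thesis using assms(1)[OF *(1)] assms(3) same_markers_replace by metis
qed

lemma rewrite_rtranclp_same_markers:
  assumes "\<And>l r. (l, r) \<in> R \<Longrightarrow> l \<noteq> [] \<and> same_markers a b l r"
    and "(rewrite A R)\<^sup>*\<^sup>* x y" "marker_word a b x"
  shows "same_markers a b x y"
  using assms(2)
proof (induction rule: rtranclp_induct)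
  case base
  then show ?case using assms(3) unfolding same_markers_def by blast
next
  case (step y z)
  then have "same_markers a b y z"
    using rewrite_same_markers[OF assms(1)] unfolding same_markers_def by blast
  then show ?case using step same_markers_trans by metis
qed

text \<open>Orientation and reduction respect \<open>same_markers\<close>, a symmetric and
  transitive relation. The nonempty left-hand sides required for replacement come from
  \<open>decreasing_rules_nonempty\<close>.\<close>

lemma kb_state_same_markers:
  assumes "kb_state A leq R0 R N P" "compatible_well_order A leq" "R0 \<subseteq> lists A \<times> lists A"
    and "\<And>l r. (l, r) \<in> R0 \<Longrightarrow> same_markers a b l r"
  shows "(\<forall>(l, r) \<in> R. same_markers a b l r) \<and> (\<forall>(p, q) \<in> P. same_markers a b p q)"
  using assms(1)
proof (induction rule: kb_state.induct)
  case (K1_K2 R)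
  then have R: "same_markers a b l r" if "(l, r) \<in> R" for l r
    using orient_rulesE(2)[of l r leq R0] that assms(4) same_markers_sym by metis
  moreover have "l \<noteq> []" if "(l, r) \<in> R" for l r
    using decreasing_rules_nonempty[OF assms(2) decreasing_orient_rules[OF assms(2,3)]] that
      K1_K2 by blast
  ultimately show ?case using critical_pairs_same_markers[of R a b] by blast
next
  case (K3 R N P Q g S)
  have R: "l \<noteq> [] \<and> same_markers a b l r" if "(l, r) \<in> R" for l r
    using decreasing_rules_nonempty[OF assms(2)] kb_state_decreasing[OF K3.hyps(1) assms(2,3)]
      K3.IH that by blast
  have g: "same_markers a b p' q'" if gQ: "(p', q') \<in> g ` Q" for p' q'
  proof -
    obtain p q where pq: "(p, q) \<in> Q" "g (p, q) = (p', q')" using gQ by (metis imageE surj_pair)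
    have "same_markers a b p q" using K3.IH K3.hyps(2) pq(1) by auto
    moreover from this have "same_markers a b p p'" "same_markers a b q q'"
      using rewrite_rtranclp_same_markers[of R a b, OF R] K3.hyps(3)[OF pq(1)] pq(2)
      by (auto simp: reduces_to_def same_markers_def)
    ultimately show ?thesis by (meson same_markers_sym same_markers_trans)
  qed
  have "same_markers a b l r" if "(l, r) \<in> S" for l r
    using orient_rulesE(2)[of l r leq "g ` Q"] that K3.hyps(4) g same_markers_sym by metis
  then show ?case using K3.IH by blast
next
  case (K4 R N)
  then have "l \<noteq> [] \<and> same_markers a b l r" if "(l, r) \<in> R" for l r
    using decreasing_rules_nonempty[OF assms(2)] kb_state_decreasing[OF _ assms(2,3)] that by blast
  then show ?case using K4.IH critical_pairs_same_markers[of R a b] by blast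
qed

section \<open>Double coset words and rules\<close>

text \<open>Describes \<open>T\<close> by properties that rewriting preserves: once both markers
  occur, their positions are forced and only letters of \<open>X\<close> remain between
  them.\<close>

lemma dc_words_iff:
  assumes "sH \<notin> X" "sK \<notin> X" "sH \<noteq> sK"
  shows "x \<in> dc_words sH sK X \<longleftrightarrow>
    x \<in> lists ({sH, sK} \<union> X) \<and> marker_word sH sK x \<and> sH \<in> set x \<and> sK \<in> set x"
proof
  assume "x \<in> dc_words sH sK X"
  then obtain w where "w \<in> lists X" "x = [sH] @ w @ [sK]" unfolding dc_words_def by blast
  then show "x \<in> lists ({sH, sK} \<union> X) \<and> marker_word sH sK x \<and> sH \<in> set x \<and> sK \<in> set x"
    using assms by (auto simp: marker_word_def butlast_append in_lists_conv_set)
next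
  assume x: "x \<in> lists ({sH, sK} \<union> X) \<and> marker_word sH sK x \<and> sH \<in> set x \<and> sK \<in> set x"
  then obtain y where y: "x = sH # y" by (cases x) (auto simp: marker_word_def)
  \<comment> \<open>\<open>sK\<close> occurs in \<open>x\<close> and differs from its first letter
    \<open>sH\<close>.\<close>
  then have "y \<noteq> []" using x assms(3) by auto
  then obtain w k where w: "x = [sH] @ w @ [k]" using y by (cases y rule: rev_cases) auto
  then have "k = sK" "w \<in> lists X"
    using x assms by (auto simp: marker_word_def butlast_append in_lists_conv_set)
  then show "x \<in> dc_words sH sK X" using w unfolding dc_words_def by blast
qed

lemma dc_rulesE:
  assumes "(l, r) \<in> dc_rules sH sK RG XH XK"
  obtains "(l, r) \<in> RG" | h where "h \<in> XH" "l = [sH] @ h" "r = [sH]"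
    | k where "k \<in> XK" "l = k @ [sK]" "r = [sK]"
  using assms unfolding dc_rules_def by blast

text \<open>Rules of \<open>RG\<close> carry no marker; the others carry the same single marker on
  both sides, \<open>sH\<close> in front or \<open>sK\<close> at the end.\<close>

lemma dc_rules_same_markers:
  assumes "RG \<subseteq> lists X \<times> lists X" "XH \<subseteq> lists X" "XK \<subseteq> lists X"
    and "sH \<notin> X" "sK \<notin> X" "sH \<noteq> sK" "(l, r) \<in> dc_rules sH sK RG XH XK"
  shows "same_markers sH sK l r"
proof -
  have free: "sH \<notin> set w \<and> sK \<notin> set w" if "w \<in> lists X" for w
    using that assms(4,5) by (auto simp: in_lists_conv_set)
  consider "l \<in> lists X" "r \<in> lists X" | h where "h \<in> lists X" "l = [sH] @ h" "r = [sH]"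
    | k where "k \<in> lists X" "l = k @ [sK]" "r = [sK]"
    using assms(7) by (cases rule: dc_rulesE) (use assms(1-3) in blast)+
  then show ?thesis
  proof cases
    case 1
    then have "marker_word sH sK l" "marker_word sH sK r"
      using free[of l] free[of r] by (auto simp: marker_word_def dest: in_set_tlD in_set_butlastD)
    then show ?thesis using 1 free unfolding same_markers_def by blast
  next
    case 2
    then show ?thesis
      using free[of h] assms(6)
      by (auto simp: same_markers_def marker_word_def dest: in_set_butlastD)
  next
    case 3
    then show ?thesis
      using free[of k] assms(6)
      by (auto simp: same_markers_def marker_word_def set_tl_append split: if_splits
          dest: in_set_tlD)
  qed
qed

theorem mainTheorem4:
  fixes G :: "('g, 'm) monoid_scheme"
    and X :: "'x set" and RG :: "'x rules" and \<theta> :: "'x list \<Rightarrow> 'g"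
    and XH XK :: "'x list set" and H K :: "'g set" and sH sK :: 'x
    and A :: "'x set" and T :: "'x list set" and R RC :: "'x rules" and leq :: "'x list rel"
  assumes "group G"
    and "monoid_presentation G X RG \<theta>"
    and "XH \<subseteq> lists X" and "XK \<subseteq> lists X"
    and "subgroup H G" and "generate G (\<theta> ` XH) = H"
    and "subgroup K G" and "generate G (\<theta> ` XK) = K"
    and "sH \<notin> X" and "sK \<notin> X" and "sH \<noteq> sK"
    and "A = {sH, sK} \<union> X"
    and "T = dc_words sH sK X"
    and "R = dc_rules sH sK RG XH XK"
    and "compatible_well_order A leq"
    and "kb_output A leq R RC"
  shows "complete_rel (restrict_to T (rewrite A RC)) \<and>
         restrict_to T (equivclp (rewrite A RC)) = restrict_to T (equivclp (rewrite A R))"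
proof -
  have RG: "RG \<subseteq> lists X \<times> lists X" using assms(2) unfolding monoid_presentation_def by blast
  have XA: "lists X \<subseteq> lists A" using assms(12) by (intro lists_mono) auto
  have "l \<in> lists A \<and> r \<in> lists A" if lr: "(l, r) \<in> R" for l r
    using lr unfolding assms(14)
  proof (cases rule: dc_rulesE)
    case 1
    then show ?thesis using RG XA by blast
  next
    case (2 h)
    then have "h \<in> lists A" using assms(3) XA by blast
    then show ?thesis using 2 assms(12) by simp
  next
    case (3 k)
    then have "k \<in> lists A" using assms(4) XA by blast
    then show ?thesis using 3 assms(12) by simp
  qed
  then have R: "R \<subseteq> lists A \<times> lists A" by (intro subrelI) blast
  have state: "kb_state A leq R RC {} {}" using assms(16) unfolding kb_output_def .
  have dec: "decreasing_rules A leq RC"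
    using kb_state_decreasing[OF state assms(15) R] by blast
  have "same_markers sH sK l r" if "(l, r) \<in> R" for l r
    using dc_rules_same_markers[OF RG assms(3,4,9,10,11)] that assms(14) by blast
  then have RC: "l \<noteq> [] \<and> same_markers sH sK l r" if "(l, r) \<in> RC" for l r
    using kb_state_same_markers[OF state assms(15) R, of sH sK]
      decreasing_rules_nonempty[OF assms(15) dec] that by blast
  \<comment> \<open>By \<open>dc_words_iff\<close>, membership in \<open>T\<close> depends only on
    the alphabet and the markers, both of which survive a rewrite step.\<close>
  have "y \<in> T" if "x \<in> T" "rewrite A RC x y" for x y
  proof -
    have "same_markers sH sK x y"
      using rewrite_same_markers[OF RC that(2)] that(1) assms(13) dc_words_iff[OF assms(9-11)]
      by blast
    moreover have "y \<in> lists A"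
      using rewrite_in_lists[OF that(2) decreasing_rules_in_lists[OF dec]] by blast
    ultimately show ?thesis
      using that(1) unfolding assms(12,13) dc_words_iff[OF assms(9-11)] same_markers_def by blast
  qed
  then have "complete_rel (restrict_to T (rewrite A RC))"
    using complete_rel_restrict_to kb_output_correct(1)[OF assms(16,15) R] by blast
  \<comment> \<open>The two congruences agree on all words, hence so do their restrictions to
    \<open>T\<close>.\<close>
  then show ?thesis using kb_output_correct(2)[OF assms(16,15) R] by simp
qed

end
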